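(* Let $\ell^2$ be the complex Hilbert space of square-summable sequences indexed by $n=0,1,2,\ldots$, and let $S:\ell^2\to\ell^2$ be the shift operator, $S(w_0,w_1,w_2,\ldots)=(0,w_0,w_1,w_2,\ldots)$. A closed non-trivial subspace $M$ of $\ell^2$ is invariant for the shift operator $S$ if and only if there exists a fixed sequence $(\lambda_n)_{n=0}^\infty$ in $M$ which satisfies either of the following conditions (c) or (d) (hence, both of them): (c) the equality $$\sum_{n=0}^\infty \left|\sum_{j=0}^n a_j\lambda_{n-j}\right|^2=\sum_{n=0}^\infty |a_n|^2$$ holds for all square-summable sequences $(a_n)_{n=0}^\infty$; (d) the equality $$\sum_{n=0}^N \left|\sum_{j=0}^n a_j\lambda_{n-j}\right|^2+\sum_{n=N+1}^\infty \left|\sum_{j=0}^N a_j\lambda_{n-j}\right|^2=\sum_{n=0}^N |a_n|^2$$ holds for all non-negative integers $N$ and for all possible choices $(a_0,a_1,\ldots,a_N)\in\mathbb{C}^{N+1}$; and such that every sequence in $M$ is of the form $$\left(\sum_{k=0}^n\lambda_k c_{n-k}\right)_{n=0}^\infty$$ for some $(c_n)_{n=0}^\infty\in\ell^2$.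
   Context: A subspace $M$ of $\ell^2$ is invariant for $S$ if $S(M)\subseteq M$. The sequences in (c) and the tuples in (d) have complex entries.
   Formalization: "Every sequence in M is of the form (Σ λ_k c_{n-k})" is read as: M consists of exactly these sequences, for all c in ℓ². With inclusion only, the "if" part fails: λ = e_0 and M = span{e_0} satisfy (c) and (d), but S e_0 is not in M. *)

theory Defs
  imports "HOL-Analysis.Analysis"
begin

definition square_summable :: "(nat \<Rightarrow> complex) \<Rightarrow> bool" where
  "square_summable w \<longleftrightarrow> summable (\<lambda>n. (cmod (w n))\<^sup>2)"

lemma square_summable_add:
  assumes "square_summable v" "square_summable w"
  shows "square_summable (\<lambda>n. v n + w n)"
  unfolding square_summable_def
proof (rule summable_comparison_test')
  show "summable (\<lambda>n. 2 * (cmod (v n))\<^sup>2 + 2 * (cmod (w n))\<^sup>2)"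
    using assms by (intro summable_add summable_mult) (auto simp: square_summable_def)
  fix n :: nat
  have "(cmod (v n + w n))\<^sup>2 \<le> (cmod (v n) + cmod (w n))\<^sup>2"
    by (intro power_mono norm_triangle_ineq norm_ge_zero)
  also have "\<dots> \<le> 2 * (cmod (v n))\<^sup>2 + 2 * (cmod (w n))\<^sup>2"
    using zero_le_power2[of "cmod (v n) - cmod (w n)"] by (simp add: power2_eq_square algebra_simps)
  finally show "norm ((cmod (v n + w n))\<^sup>2) \<le> 2 * (cmod (v n))\<^sup>2 + 2 * (cmod (w n))\<^sup>2"
    by simp
qed

lemma square_summable_scale:
  assumes "square_summable w"
  shows "square_summable (\<lambda>n. c * w n)"
  using summable_mult[of "\<lambda>n. (cmod (w n))\<^sup>2" "(cmod c)\<^sup>2"] assms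
  by (simp add: square_summable_def norm_mult power_mult_distrib)

lemma square_summable_zero: "square_summable (\<lambda>n. 0)"
  by (simp add: square_summable_def)

lemma square_summable_inner:
  assumes "square_summable v" "square_summable w"
  shows "summable (\<lambda>n. v n \<bullet> w n)"
proof (rule summable_comparison_test')
  show "summable (\<lambda>n. (cmod (v n))\<^sup>2 + (cmod (w n))\<^sup>2)"
    using assms by (intro summable_add) (auto simp: square_summable_def)
  fix n :: nat
  have "\<bar>v n \<bullet> w n\<bar> \<le> cmod (v n) * cmod (w n)"
    by (rule Cauchy_Schwarz_ineq2)
  also have "\<dots> \<le> (cmod (v n))\<^sup>2 + (cmod (w n))\<^sup>2"
  proof -
    have "0 \<le> (cmod (v n) - cmod (w n))\<^sup>2 + (cmod (v n))\<^sup>2 + (cmod (w n))\<^sup>2" by simp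
    then show ?thesis by (simp add: power2_eq_square algebra_simps)
  qed
  finally show "norm (v n \<bullet> w n) \<le> (cmod (v n))\<^sup>2 + (cmod (w n))\<^sup>2" by simp
qed

typedef ell2 = "{w :: nat \<Rightarrow> complex. square_summable w}"
  morphisms ell2_nth Abs_ell2
  using square_summable_zero by blast

setup_lifting type_definition_ell2

lemma ell2_eqI: "(\<And>n. ell2_nth v n = ell2_nth w n) \<Longrightarrow> v = w"
  by (simp add: ell2_nth_inject[symmetric] ext)

lemma square_summable_ell2_nth: "square_summable (ell2_nth w)"
  using ell2_nth by blast

text \<open>
  The real inner product below is the real part of the usual complex one, so the norm and
  hence the topology are the usual ones of the complex Hilbert space.
\<close>

instantiation ell2 :: real_inner
begin

lift_definition zero_ell2 :: ell2 is "\<lambda>n. 0"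
  by (rule square_summable_zero)

lift_definition plus_ell2 :: "ell2 \<Rightarrow> ell2 \<Rightarrow> ell2" is "\<lambda>v w n. v n + w n"
  by (rule square_summable_add)

lift_definition uminus_ell2 :: "ell2 \<Rightarrow> ell2" is "\<lambda>w n. - w n"
  by (simp add: square_summable_def)

lift_definition minus_ell2 :: "ell2 \<Rightarrow> ell2 \<Rightarrow> ell2" is "\<lambda>v w n. v n - w n"
  using square_summable_add square_summable_scale[of _ "-1"] by fastforce

lift_definition scaleR_ell2 :: "real \<Rightarrow> ell2 \<Rightarrow> ell2" is "\<lambda>r w n. r *\<^sub>R w n"
  using square_summable_scale by (simp add: scaleR_conv_of_real)

definition inner_ell2 :: "ell2 \<Rightarrow> ell2 \<Rightarrow> real" where
  "inner_ell2 v w = (\<Sum>n. ell2_nth v n \<bullet> ell2_nth w n)"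

definition norm_ell2 :: "ell2 \<Rightarrow> real" where
  "norm_ell2 w = sqrt (\<Sum>n. (cmod (ell2_nth w n))\<^sup>2)"

definition dist_ell2 :: "ell2 \<Rightarrow> ell2 \<Rightarrow> real" where
  "dist_ell2 v w = norm (v - w)"

definition sgn_ell2 :: "ell2 \<Rightarrow> ell2" where
  "sgn_ell2 w = inverse (norm w) *\<^sub>R w"

definition uniformity_ell2 :: "(ell2 \<times> ell2) filter" where
  "uniformity_ell2 = (INF e\<in>{0 <..}. principal {(v, w). dist v w < e})"

definition open_ell2 :: "ell2 set \<Rightarrow> bool" where
  "open_ell2 U \<longleftrightarrow> (\<forall>w\<in>U. eventually (\<lambda>(w', v). w' = w \<longrightarrow> v \<in> U) uniformity)"

instance
proof
  fix u v w :: ell2 and r s :: real and U :: "ell2 set"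
  note inner_summable = square_summable_inner[OF square_summable_ell2_nth square_summable_ell2_nth]
  show "u + v + w = u + (v + w)" by transfer (simp add: add.assoc)
  show "u + v = v + u" by transfer (simp add: add.commute)
  show "0 + u = u" by transfer simp
  show "- u + u = 0" by transfer simp
  show "u - v = u + - v" by transfer simp
  show "r *\<^sub>R (u + v) = r *\<^sub>R u + r *\<^sub>R v" by transfer (simp add: scaleR_add_right)
  show "(r + s) *\<^sub>R u = r *\<^sub>R u + s *\<^sub>R u" by transfer (simp add: scaleR_add_left)
  show "r *\<^sub>R s *\<^sub>R u = (r * s) *\<^sub>R u" by transfer simp
  show "1 *\<^sub>R u = u" by transfer simp
  show "dist u v = norm (u - v)" by (rule dist_ell2_def)
  show "sgn u = inverse (norm u) *\<^sub>R u" by (rule sgn_ell2_def)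
  show "uniformity = (INF e\<in>{0 <..}. principal {(v, w :: ell2). dist v w < e})"
    by (rule uniformity_ell2_def)
  show "open U \<longleftrightarrow> (\<forall>w\<in>U. eventually (\<lambda>(w', v). w' = w \<longrightarrow> v \<in> U) uniformity)"
    by (rule open_ell2_def)
  show "u \<bullet> v = v \<bullet> u" by (simp add: inner_ell2_def inner_commute)
  show "(u + v) \<bullet> w = u \<bullet> w + v \<bullet> w"
    by (simp add: inner_ell2_def plus_ell2.rep_eq inner_add_left suminf_add inner_summable)
  show "(r *\<^sub>R u) \<bullet> v = r * (u \<bullet> v)"
    unfolding inner_ell2_def scaleR_ell2.rep_eq inner_scaleR_left
    by (rule suminf_mult[OF inner_summable])
  show "0 \<le> u \<bullet> u"
    unfolding inner_ell2_def by (intro suminf_nonneg inner_summable) simp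
  show "u \<bullet> u = 0 \<longleftrightarrow> u = 0"
  proof -
    have "u \<bullet> u = 0 \<longleftrightarrow> (\<forall>n. ell2_nth u n \<bullet> ell2_nth u n = 0)"
      unfolding inner_ell2_def by (intro suminf_eq_zero_iff inner_summable) simp
    also have "\<dots> \<longleftrightarrow> u = 0" by transfer auto
    finally show ?thesis .
  qed
  show "norm u = sqrt (u \<bullet> u)"
    by (simp add: norm_ell2_def inner_ell2_def power2_norm_eq_inner)
qed

end

lift_definition scaleC :: "complex \<Rightarrow> ell2 \<Rightarrow> ell2" is "\<lambda>c w n. c * w n"
  by (rule square_summable_scale)

interpretation complex_ell2: vector_space scaleC
  by unfold_locales (transfer; simp add: algebra_simps)+

lift_definition shift :: "ell2 \<Rightarrow> ell2" is "\<lambda>w n. case n of 0 \<Rightarrow> 0 | Suc m \<Rightarrow> w m"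
proof -
  fix w :: "nat \<Rightarrow> complex"
  assume "square_summable w"
  then show "square_summable (\<lambda>n. case n of 0 \<Rightarrow> 0 | Suc m \<Rightarrow> w m)"
    unfolding square_summable_def by (subst summable_Suc_iff[symmetric]) simp
qed

text \<open>
  The summability clauses are needed because \<^term>\<open>suminf\<close> is unspecified on divergent series;
  an equality with a finite right-hand side asserts convergence of the left-hand side.
\<close>

definition condition_c :: "(nat \<Rightarrow> complex) \<Rightarrow> bool" where
  "condition_c l \<longleftrightarrow>
    (\<forall>a. square_summable a \<longrightarrow>
      summable (\<lambda>n. (cmod (\<Sum>j\<le>n. a j * l (n - j)))\<^sup>2) \<and>
      (\<Sum>n. (cmod (\<Sum>j\<le>n. a j * l (n - j)))\<^sup>2) = (\<Sum>n. (cmod (a n))\<^sup>2))"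

text \<open>
  A tuple \<open>(a\<^sub>0, \<dots>, a\<^sub>N)\<close> is given by a function on \<^typ>\<open>nat\<close> of which only the values at
  indices up to \<open>N\<close> are used. The series over \<open>n \<ge> N + 1\<close> is reindexed by \<open>n = m + (N + 1)\<close>.
\<close>

definition condition_d :: "(nat \<Rightarrow> complex) \<Rightarrow> bool" where
  "condition_d l \<longleftrightarrow>
    (\<forall>N. \<forall>a :: nat \<Rightarrow> complex.
      summable (\<lambda>m. (cmod (\<Sum>j\<le>N. a j * l (m + (N + 1) - j)))\<^sup>2) \<and>
      (\<Sum>n\<le>N. (cmod (\<Sum>j\<le>n. a j * l (n - j)))\<^sup>2)
        + (\<Sum>m. (cmod (\<Sum>j\<le>N. a j * l (m + (N + 1) - j)))\<^sup>2)
      = (\<Sum>n\<le>N. (cmod (a n))\<^sup>2))"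

end

theory Submission
  imports Defs
begin

text \<open>
  Let \<open>S\<close> be the shift. For a nonzero closed invariant \<open>M\<close>, there is a unit vector \<open>l \<in> M\<close>
  orthogonal to \<open>S M\<close>; its shifts \<open>S\<^sup>n l\<close> are then orthonormal, which is condition (d), and
  convolution with \<open>l\<close> is an isometry of \<open>\<ell>\<^sup>2\<close> into \<open>M\<close>, with closed range. If \<open>f \<in> M\<close> is
  orthogonal to that range, then \<open>S\<^sup>n f\<close> is orthogonal to \<open>S\<^sup>p l\<close> for all \<open>n\<close> and \<open>p\<close>: for \<open>n \<le> p\<close> by
  the choice of \<open>f\<close>, for \<open>n > p\<close> because \<open>l\<close> is orthogonal to \<open>S M\<close>. On the circle this says that
  \<open>f\<close> times the conjugate of \<open>l\<close> has no Fourier coefficients while \<open>l\<close> has modulus one, so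
  \<open>f = 0\<close>; the proof below replaces the boundary functions by truncated correlation sums.
\<close>

subsection \<open>Completeness of the sequence space and elements of minimal norm\<close>

text \<open>A Fatou-type criterion: bounds on finite partial sums survive coordinatewise limits. It
  serves both for completeness and for the boundedness of convolution.\<close>

lemma ell2_norm_le:
  assumes "\<And>K. (\<Sum>n<K. (cmod (w n))\<^sup>2) \<le> B\<^sup>2" "0 \<le> B"
  shows "square_summable w" "norm (Abs_ell2 w) \<le> B"
proof -
  show sq: "square_summable w"
    unfolding square_summable_def by (rule summableI_nonneg_bounded) (use assms in auto)
  have "(\<Sum>n. (cmod (w n))\<^sup>2) \<le> B\<^sup>2"
    using sq assms by (intro suminf_le_const) (auto simp: square_summable_def)
  then have "sqrt (\<Sum>n. (cmod (w n))\<^sup>2) \<le> sqrt (B\<^sup>2)"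
    by (rule real_sqrt_le_mono)
  then show "norm (Abs_ell2 w) \<le> B"
    using sq assms(2) by (simp add: norm_ell2_def Abs_ell2_inverse)
qed

lemma summable_ell2: "summable (\<lambda>n. (cmod (ell2_nth w n))\<^sup>2)"
  using square_summable_ell2_nth by (simp add: square_summable_def)

lemma norm_ell2_sq: "(norm w)\<^sup>2 = (\<Sum>n. (cmod (ell2_nth w n))\<^sup>2)"
  by (simp add: norm_ell2_def suminf_nonneg summable_ell2)

lemma ell2_partial_sum_le:
  assumes "finite I" shows "(\<Sum>n\<in>I. (cmod (ell2_nth w n))\<^sup>2) \<le> (norm w)\<^sup>2"
  unfolding norm_ell2_sq using assms by (intro sum_le_suminf summable_ell2) auto

lemma cmod_ell2_nth_le: "cmod (ell2_nth w n) \<le> norm w"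
  using ell2_partial_sum_le[of "{n}" w] by (simp add: power2_le_iff_abs_le)

lemma bounded_linear_ell2_nth: "bounded_linear (\<lambda>w. ell2_nth w n)"
  by (rule bounded_linear_intro[where K = 1])
     (simp_all add: plus_ell2.rep_eq scaleR_ell2.rep_eq cmod_ell2_nth_le)

instance ell2 :: complete_space
proof
  fix X :: "nat \<Rightarrow> ell2"
  assume X: "Cauchy X"
  have "\<exists>z. (\<lambda>i. ell2_nth (X i) n) \<longlonglongrightarrow> z" for n
    using bounded_linear.Cauchy[OF bounded_linear_ell2_nth X, of n]
    by (simp add: Cauchy_convergent_iff convergent_def)
  then obtain w where w: "\<And>n. (\<lambda>i. ell2_nth (X i) n) \<longlonglongrightarrow> w n"
    by metis
  have *: "\<exists>N. \<forall>i\<ge>N. square_summable (\<lambda>n. ell2_nth (X i) n - w n) \<and>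
      norm (Abs_ell2 (\<lambda>n. ell2_nth (X i) n - w n)) \<le> e" if e: "e > 0" for e
  proof -
    obtain N where N: "\<And>i j. i \<ge> N \<Longrightarrow> j \<ge> N \<Longrightarrow> norm (X i - X j) < e"
      using CauchyD[OF X e] by blast
    \<comment> \<open>The sum is finite, so the Cauchy estimate passes to the limit in
      \<open>j\<close>; the resulting bound does not depend on \<open>K\<close>.\<close>
    have "(\<Sum>n<K. (cmod (ell2_nth (X i) n - w n))\<^sup>2) \<le> e\<^sup>2" if i: "i \<ge> N" for i K
    proof (rule Lim_bounded)
      show "(\<lambda>j. \<Sum>n<K. (cmod (ell2_nth (X i) n - ell2_nth (X j) n))\<^sup>2)
          \<longlonglongrightarrow> (\<Sum>n<K. (cmod (ell2_nth (X i) n - w n))\<^sup>2)"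
        by (intro tendsto_intros w)
      show "\<forall>j\<ge>N. (\<Sum>n<K. (cmod (ell2_nth (X i) n - ell2_nth (X j) n))\<^sup>2) \<le> e\<^sup>2"
      proof (intro allI impI)
        fix j assume "j \<ge> N"
        then have "(norm (X i - X j))\<^sup>2 \<le> e\<^sup>2"
          using N[OF i] by (intro power_mono) (auto intro: less_imp_le)
        then show "(\<Sum>n<K. (cmod (ell2_nth (X i) n - ell2_nth (X j) n))\<^sup>2) \<le> e\<^sup>2"
          using ell2_partial_sum_le[of "{..<K}" "X i - X j"] by (simp add: minus_ell2.rep_eq)
      qed
    qed
    then show ?thesis
      using ell2_norm_le e by (meson less_imp_le)
  qed
  obtain N where "square_summable (\<lambda>n. ell2_nth (X N) n - w n)"
    using *[of 1] by auto
  from square_summable_add[OF square_summable_scale[OF this, of "-1"] square_summable_ell2_nth[of "X N"]]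
  have sq: "square_summable w"
    by simp
  have diff: "Abs_ell2 (\<lambda>n. ell2_nth (X i) n - w n) = X i - Abs_ell2 w" for i
    using square_summable_add[OF square_summable_ell2_nth[of "X i"] square_summable_scale[OF sq, of "-1"]]
    by (intro ell2_eqI) (simp add: Abs_ell2_inverse minus_ell2.rep_eq sq)
  have "X \<longlonglongrightarrow> Abs_ell2 w"
  proof (rule LIMSEQ_I)
    fix e :: real assume "e > 0"
    then obtain N where "\<forall>i\<ge>N. norm (X i - Abs_ell2 w) \<le> e / 2"
      using *[of "e / 2"] by (auto simp: diff)
    then have "\<forall>i\<ge>N. norm (X i - Abs_ell2 w) < e"
      using \<open>e > 0\<close> by fastforce
    then show "\<exists>N. \<forall>i\<ge>N. norm (X i - Abs_ell2 w) < e" ..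
  qed
  then show "convergent X"
    by (auto simp: convergent_def)
qed

text \<open>Cantor's intersection theorem applies to the nested sets \<open>F n\<close> of
  near-minimizers, whose diameters tend to 0 by the parallelogram law.\<close>

lemma ex_min_norm:
  fixes A :: "'a::{real_inner,complete_space} set"
  assumes "closed A" "convex A" "A \<noteq> {}"
  shows "\<exists>x\<in>A. \<forall>y\<in>A. norm x \<le> norm y"
proof -
  define d where "d = Inf (norm ` A)"
  have bdd: "bdd_below (norm ` A)"
    by (rule bdd_belowI[of _ 0]) auto
  have d: "d \<le> norm x" if "x \<in> A" for x
    unfolding d_def using bdd that by (intro cInf_lower) auto
  have d0: "d \<ge> 0"
    unfolding d_def using assms(3) by (intro cInf_greatest) auto
  define F where "F = (\<lambda>n. A \<inter> {x. norm x \<le> d + 1 / real (Suc n)})"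
  obtain a where a: "\<And>n. a \<in> F n"
  proof (rule decreasing_closed_nest[of F])
    show "closed (F n)" for n
      unfolding F_def by (intro closed_Int assms closed_Collect_le continuous_intros)
    show "F n \<noteq> {}" for n
    proof -
      have "\<exists>y\<in>norm ` A. y < d + 1 / real (Suc n)"
        unfolding d_def using assms(3) bdd by (subst cInf_less_iff[symmetric]) auto
      then show ?thesis
        by (force simp: F_def)
    qed
    show "F n \<subseteq> F m" if "m \<le> n" for m n
    proof -
      have "1 / real (Suc n) \<le> 1 / real (Suc m)"
        using that by (simp add: frac_le)
      then show ?thesis
        by (auto simp: F_def)
    qed
    fix e :: real assume e: "e > 0"
    \<comment> \<open>This quantity will bound the squared distance of any two points of
      \<open>F n\<close>.\<close>
    have "(\<lambda>n. 4 * (d + 1 / real (Suc n))\<^sup>2 - 4 * d\<^sup>2) \<longlonglongrightarrow> 4 * (d + 0)\<^sup>2 - 4 * d\<^sup>2"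
      by (intro tendsto_intros LIMSEQ_Suc[OF lim_1_over_n])
    then have "\<forall>\<^sub>F n in sequentially. 4 * (d + 1 / real (Suc n))\<^sup>2 - 4 * d\<^sup>2 < e\<^sup>2"
      by (rule order_tendstoD) (use e in simp)
    then obtain n where n: "4 * (d + 1 / real (Suc n))\<^sup>2 - 4 * d\<^sup>2 < e\<^sup>2"
      by (auto simp: eventually_sequentially)
    have "dist x y < e" if "x \<in> F n" "y \<in> F n" for x y
    proof -
      \<comment> \<open>Convexity puts the midpoint into \<open>A\<close>, which bounds
        \<open>norm (x + y)\<close> below by \<open>2 * d\<close>.\<close>
      have "(1/2) *\<^sub>R x + (1/2) *\<^sub>R y \<in> A"
        using that assms(2) by (intro convexD) (auto simp: F_def)
      then have "d \<le> norm ((1/2) *\<^sub>R x + (1/2) *\<^sub>R y)"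
        by (rule d)
      also have "(1/2) *\<^sub>R x + (1/2) *\<^sub>R y = (1/2) *\<^sub>R (x + y)"
        by (simp add: scaleR_add_right)
      finally have "2 * d \<le> norm (x + y)"
        by simp
      then have "(2 * d)\<^sup>2 \<le> (norm (x + y))\<^sup>2"
        using d0 by (intro power_mono) auto
      moreover have "(norm x)\<^sup>2 \<le> (d + 1 / real (Suc n))\<^sup>2" "(norm y)\<^sup>2 \<le> (d + 1 / real (Suc n))\<^sup>2"
        using that by (auto simp: F_def intro!: power_mono)
      moreover have "(norm (x - y))\<^sup>2 = 2 * (norm x)\<^sup>2 + 2 * (norm y)\<^sup>2 - (norm (x + y))\<^sup>2"
        by (simp add: power2_norm_eq_inner inner_add_left inner_add_right inner_diff_left
            inner_diff_right inner_commute)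
      ultimately have "(norm (x - y))\<^sup>2 < e\<^sup>2"
        using n by (simp add: power_mult_distrib)
      then show ?thesis
        using e by (simp add: dist_norm power2_less_imp_less)
    qed
    then show "\<exists>n. \<forall>x\<in>F n. \<forall>y\<in>F n. dist x y < e"
      by blast
  qed (use that in blast)
  have "norm a \<le> d"
  proof (rule LIMSEQ_le_const)
    show "(\<lambda>n. d + 1 / real (Suc n)) \<longlonglongrightarrow> d"
      using tendsto_add[OF tendsto_const LIMSEQ_Suc[OF lim_1_over_n], of d] by simp
    show "\<exists>N. \<forall>n\<ge>N. norm a \<le> d + 1 / real (Suc n)"
      using a by (auto simp: F_def)
  qed
  moreover have "a \<in> A"
    using a[of 0] by (simp add: F_def)
  ultimately show ?thesis
    using d order_trans by blast
qed

text \<open>Testing minimality with both \<open>x + g\<close> and \<open>x - g\<close> turns the variational inequality into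
  an equality.\<close>

lemma min_norm_orthogonal:
  fixes A :: "'a::real_inner set"
  assumes "closed A" "convex A" "x \<in> A" "\<forall>y\<in>A. norm x \<le> norm y"
    and "x + g \<in> A" "x - g \<in> A"
  shows "x \<bullet> g = 0"
  using any_closest_point_dot[OF assms(2,1,3,5), of 0] any_closest_point_dot[OF assms(2,1,3,6), of 0] assms(4)
  by simp

subsection \<open>Sums of shifted sequences\<close>

lemma linear_shift: "linear shift"
  by (rule linearI; transfer; simp add: fun_eq_iff split: nat.splits)

lemma scaleR_conv_scaleC: "r *\<^sub>R x = scaleC (of_real r) x"
  by transfer (simp add: scaleR_conv_of_real)

lemma norm_scaleC: "norm (scaleC z x) = cmod z * norm x"
proof (rule power2_eq_imp_eq)
  show "(norm (scaleC z x))\<^sup>2 = (cmod z * norm x)\<^sup>2"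
    by (simp add: norm_ell2_sq scaleC.rep_eq norm_mult power_mult_distrib suminf_mult summable_ell2)
qed auto

lemma inner_scaleC_left: "scaleC z x \<bullet> y = x \<bullet> scaleC (cnj z) y"
  unfolding inner_ell2_def scaleC.rep_eq
  by (rule arg_cong[where f = suminf]) (auto simp: fun_eq_iff inner_complex_def algebra_simps)

lemma complex_subspace_imp_subspace: "complex_ell2.subspace M \<Longrightarrow> subspace M"
  unfolding subspace_def complex_ell2.subspace_def by (simp add: scaleR_conv_scaleC)

lemma shift_scaleC: "shift (scaleC z x) = scaleC z (shift x)"
  by transfer (simp add: fun_eq_iff split: nat.splits)

lemma inner_shift_shift: "shift x \<bullet> shift y = x \<bullet> y"
proof -
  have "(\<lambda>n. ell2_nth (shift x) n \<bullet> ell2_nth (shift y) n) sums (shift x \<bullet> shift y)"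
    unfolding inner_ell2_def by (intro summable_sums square_summable_inner square_summable_ell2_nth)
  then have "(\<lambda>n. ell2_nth (shift x) (Suc n) \<bullet> ell2_nth (shift y) (Suc n)) sums (shift x \<bullet> shift y)"
    by (subst sums_Suc_iff) (simp add: shift.rep_eq)
  then show ?thesis
    by (simp add: shift.rep_eq inner_ell2_def sums_iff)
qed

lemma norm_shift: "norm (shift x) = norm x"
  by (simp add: norm_eq_sqrt_inner inner_shift_shift)

lemma funpow_shift_scaleC: "(shift ^^ k) (scaleC z x) = scaleC z ((shift ^^ k) x)"
  by (induction k) (simp_all add: shift_scaleC)

lemma inner_funpow_shift: "(shift ^^ k) x \<bullet> (shift ^^ k) y = x \<bullet> y"
  by (induction k) (simp_all add: inner_shift_shift)

lemma ell2_nth_funpow_shift: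
  "ell2_nth ((shift ^^ k) x) n = (if k \<le> n then ell2_nth x (n - k) else 0)"
  by (induction k arbitrary: n) (auto simp: shift.rep_eq split: nat.splits)

lemma ell2_nth_sum: "ell2_nth (\<Sum>i\<in>I. f i) n = (\<Sum>i\<in>I. ell2_nth (f i) n)"
  by (induction I rule: infinite_finite_induct) (simp_all add: zero_ell2.rep_eq plus_ell2.rep_eq)

text \<open>In the function model this is the product of the polynomial with coefficients
  \<open>a 0, ..., a N\<close> and the function with coefficients \<open>ell2_nth l\<close>.\<close>

definition shift_sum :: "ell2 \<Rightarrow> (nat \<Rightarrow> complex) \<Rightarrow> nat \<Rightarrow> ell2" where
  "shift_sum l a N = (\<Sum>j\<le>N. scaleC (a j) ((shift ^^ j) l))"

lemma ell2_nth_shift_sum: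
  "ell2_nth (shift_sum l a N) n = (\<Sum>j\<le>min n N. a j * ell2_nth l (n - j))"
proof -
  have "(\<Sum>j\<le>min n N. a j * ell2_nth l (n - j)) =
      (\<Sum>j\<le>N. if j \<le> n then a j * ell2_nth l (n - j) else 0)"
    by (intro sum.mono_neutral_cong_left) auto
  also have "\<dots> = (\<Sum>j\<le>N. ell2_nth (scaleC (a j) ((shift ^^ j) l)) n)"
    by (intro sum.cong) (auto simp: scaleC.rep_eq ell2_nth_funpow_shift)
  finally show ?thesis
    by (simp add: shift_sum_def ell2_nth_sum)
qed

text \<open>The two sums in (d) are the head and the tail of the squared norm of
  \<open>shift_sum l a N\<close>: the inner sum stops at \<open>n\<close> while
  \<open>n \<le> N\<close> and at \<open>N\<close> afterwards. So (d) says that the shifts of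
  \<open>l\<close> are orthonormal.\<close>

lemma condition_d_iff:
  "condition_d (ell2_nth l) \<longleftrightarrow> (\<forall>N a. (norm (shift_sum l a N))\<^sup>2 = (\<Sum>n\<le>N. (cmod (a n))\<^sup>2))"
proof -
  have "summable (\<lambda>m. (cmod (\<Sum>j\<le>N. a j * ell2_nth l (m + (N + 1) - j)))\<^sup>2)" (is ?thesis1)
    and "(norm (shift_sum l a N))\<^sup>2 = (\<Sum>n\<le>N. (cmod (\<Sum>j\<le>n. a j * ell2_nth l (n - j)))\<^sup>2)
        + (\<Sum>m. (cmod (\<Sum>j\<le>N. a j * ell2_nth l (m + (N + 1) - j)))\<^sup>2)" (is ?thesis2) for N a
  proof -
    have "ell2_nth (shift_sum l a N) (m + (N + 1)) = (\<Sum>j\<le>N. a j * ell2_nth l (m + (N + 1) - j))" for m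
      by (simp add: ell2_nth_shift_sum min_def)
    moreover have "(\<Sum>n<N + 1. (cmod (ell2_nth (shift_sum l a N) n))\<^sup>2) =
        (\<Sum>n\<le>N. (cmod (\<Sum>j\<le>n. a j * ell2_nth l (n - j)))\<^sup>2)"
      by (intro sum.cong) (auto simp: ell2_nth_shift_sum min_def)
    ultimately show ?thesis1 ?thesis2
      using summable_ignore_initial_segment[OF summable_ell2, of "shift_sum l a N" "N + 1"]
        suminf_split_initial_segment[OF summable_ell2, of "shift_sum l a N" "N + 1"]
      by (simp_all add: norm_ell2_sq)
  qed
  then show ?thesis
    by (simp add: condition_d_def)
qed

lemma shift_sum_in_subspace:
  assumes "complex_ell2.subspace M" "shift ` M \<subseteq> M" "l \<in> M"
  shows "shift_sum l a N \<in> M"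
proof -
  have "(shift ^^ j) l \<in> M" for j
    using assms by (induction j) auto
  then show ?thesis
    unfolding shift_sum_def using assms(1)
    by (intro complex_ell2.subspace_sum complex_ell2.subspace_scale)
qed

text \<open>Peeling off the zeroth term leaves a shifted sum of the same shape, which is orthogonal to
  \<open>l\<close>, so the Pythagorean theorem applies inductively.\<close>

lemma norm_shift_sum_wandering:
  assumes M: "complex_ell2.subspace M" "shift ` M \<subseteq> M" "l \<in> M"
    and l: "norm l = 1" "\<And>x. x \<in> M \<Longrightarrow> l \<bullet> shift x = 0"
  shows "(norm (shift_sum l a N))\<^sup>2 = (\<Sum>n\<le>N. (cmod (a n))\<^sup>2)"
proof (induction N arbitrary: a)
  case 0
  then show ?case
    by (simp add: shift_sum_def norm_scaleC l power_mult_distrib)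
next
  case (Suc N)
  define y where "y = shift_sum l (\<lambda>n. a (Suc n)) N"
  have "shift_sum l a (Suc N) = scaleC (a 0) l + shift y"
    unfolding shift_sum_def y_def
    by (subst sum.atMost_Suc_shift) (simp add: linear_sum[OF linear_shift] shift_scaleC)
  \<comment> \<open>The hypothesis on \<open>l\<close> concerns the real inner product, so the
    complex scalar is moved across as \<open>cnj (a 0)\<close> and absorbed into
    \<open>M\<close>.\<close>
  moreover have "scaleC (cnj (a 0)) y \<in> M"
    unfolding y_def using M by (intro complex_ell2.subspace_scale shift_sum_in_subspace)
  then have "scaleC (a 0) l \<bullet> shift y = 0"
    using l(2) by (simp add: inner_scaleC_left flip: shift_scaleC)
  ultimately have "(norm (shift_sum l a (Suc N)))\<^sup>2 = (norm (scaleC (a 0) l))\<^sup>2 + (norm (shift y))\<^sup>2"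
    by (simp add: power2_norm_eq_inner inner_add_left inner_add_right inner_commute)
  also have "\<dots> = (\<Sum>n\<le>Suc N. (cmod (a n))\<^sup>2)"
    unfolding norm_shift y_def Suc by (subst sum.atMost_Suc_shift) (simp add: norm_scaleC l)
  finally show ?case .
qed

subsection \<open>Convolution operators\<close>

text \<open>The argument is an arbitrary function, so that every tuple in (d) becomes a vector of
  \<open>ell2\<close>.\<close>

lift_definition ell2_trunc :: "nat \<Rightarrow> (nat \<Rightarrow> complex) \<Rightarrow> ell2" is "\<lambda>N a n. if n \<le> N then a n else 0"
proof -
  fix N :: nat and a :: "nat \<Rightarrow> complex"
  show "square_summable (\<lambda>n. if n \<le> N then a n else 0)"
    unfolding square_summable_def by (rule summable_finite[of "{..N}"]) auto
qed

lemma norm_ell2_trunc: "(norm (ell2_trunc N a))\<^sup>2 = (\<Sum>n\<le>N. (cmod (a n))\<^sup>2)"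
proof -
  have "(\<Sum>n. (cmod (ell2_nth (ell2_trunc N a) n))\<^sup>2) = (\<Sum>n\<le>N. (cmod (ell2_nth (ell2_trunc N a) n))\<^sup>2)"
    by (rule suminf_finite) (auto simp: ell2_trunc.rep_eq)
  then show ?thesis
    by (simp add: norm_ell2_sq ell2_trunc.rep_eq)
qed

text \<open>The error is orthogonal to the truncation, so its squared norm is the remainder of the
  series for the squared norm of \<open>w\<close>.\<close>

lemma ell2_trunc_tendsto: "(\<lambda>N. ell2_trunc N (ell2_nth w)) \<longlonglongrightarrow> w"
proof -
  have "(norm (w - ell2_trunc N (ell2_nth w)))\<^sup>2 = (norm w)\<^sup>2 - (\<Sum>n\<le>N. (cmod (ell2_nth w n))\<^sup>2)" for N
  proof -
    define t where "t = ell2_trunc N (ell2_nth w)"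
    have "w \<bullet> t = t \<bullet> t"
      unfolding inner_ell2_def
      by (rule arg_cong[where f = suminf]) (auto simp: fun_eq_iff t_def ell2_trunc.rep_eq)
    then have "(norm (w - t))\<^sup>2 = (norm w)\<^sup>2 - (norm t)\<^sup>2"
      by (simp add: power2_norm_eq_inner inner_diff_left inner_diff_right inner_commute)
    then show ?thesis
      by (simp add: t_def norm_ell2_trunc)
  qed
  moreover have "(\<lambda>N. (norm w)\<^sup>2 - (\<Sum>n\<le>N. (cmod (ell2_nth w n))\<^sup>2)) \<longlonglongrightarrow> (norm w)\<^sup>2 - (norm w)\<^sup>2"
    unfolding norm_ell2_sq[of w] by (intro tendsto_intros summable_LIMSEQ' summable_ell2)
  ultimately have "(\<lambda>N. (norm (w - ell2_trunc N (ell2_nth w)))\<^sup>2) \<longlonglongrightarrow> 0"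
    by simp
  then have "(\<lambda>N. sqrt ((norm (w - ell2_trunc N (ell2_nth w)))\<^sup>2)) \<longlonglongrightarrow> sqrt 0"
    by (rule tendsto_real_sqrt)
  then have "(\<lambda>N. dist (ell2_trunc N (ell2_nth w)) w) \<longlonglongrightarrow> 0"
    by (simp add: dist_norm norm_minus_commute)
  then show ?thesis
    by (rule tendsto_dist_iff[THEN iffD2])
qed

text \<open>The convolution operator with symbol \<open>l\<close>; meaningful only when the convolution
  is square-summable, e.g. under \<^term>\<open>condition_d (ell2_nth l)\<close>.\<close>

definition toeplitz :: "ell2 \<Rightarrow> ell2 \<Rightarrow> ell2" where
  "toeplitz l c = Abs_ell2 (\<lambda>n. \<Sum>j\<le>n. ell2_nth c j * ell2_nth l (n - j))"

text \<open>Below index \<open>K\<close> the convolution agrees with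
  \<open>shift_sum l (ell2_nth c) K\<close>, whose norm is controlled by (d) uniformly in
  \<open>K\<close>.\<close>

lemma
  assumes "condition_d (ell2_nth l)"
  shows square_summable_convolution: "square_summable (\<lambda>n. \<Sum>j\<le>n. ell2_nth c j * ell2_nth l (n - j))"
    and norm_toeplitz_le: "norm (toeplitz l c) \<le> norm c"
proof -
  have *: "(\<Sum>n<K. (cmod (\<Sum>j\<le>n. ell2_nth c j * ell2_nth l (n - j)))\<^sup>2) \<le> (norm c)\<^sup>2" for K
  proof -
    have "(\<Sum>n<K. (cmod (\<Sum>j\<le>n. ell2_nth c j * ell2_nth l (n - j)))\<^sup>2)
        = (\<Sum>n<K. (cmod (ell2_nth (shift_sum l (ell2_nth c) K) n))\<^sup>2)"
      by (intro sum.cong) (auto simp: ell2_nth_shift_sum min_def)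
    also have "\<dots> \<le> (norm (shift_sum l (ell2_nth c) K))\<^sup>2"
      by (rule ell2_partial_sum_le) simp
    also have "\<dots> \<le> (norm c)\<^sup>2"
      using assms ell2_partial_sum_le[of "{..K}" c] by (simp add: condition_d_iff)
    finally show ?thesis .
  qed
  show "square_summable (\<lambda>n. \<Sum>j\<le>n. ell2_nth c j * ell2_nth l (n - j))"
    by (rule ell2_norm_le(1)[OF *]) simp
  show "norm (toeplitz l c) \<le> norm c"
    unfolding toeplitz_def by (rule ell2_norm_le(2)[OF *]) simp
qed

lemma ell2_nth_toeplitz:
  assumes "condition_d (ell2_nth l)"
  shows "ell2_nth (toeplitz l c) n = (\<Sum>j\<le>n. ell2_nth c j * ell2_nth l (n - j))"
  unfolding toeplitz_def using square_summable_convolution[OF assms] by (simp add: Abs_ell2_inverse)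

lemma toeplitz_scaleC:
  assumes "condition_d (ell2_nth l)"
  shows "toeplitz l (scaleC z c) = scaleC z (toeplitz l c)"
  by (rule ell2_eqI) (simp add: ell2_nth_toeplitz[OF assms] scaleC.rep_eq sum_distrib_left mult.assoc)

lemma bounded_linear_toeplitz:
  assumes "condition_d (ell2_nth l)"
  shows "bounded_linear (toeplitz l)"
proof (rule bounded_linear_intro[where K = 1])
  show "toeplitz l (x + y) = toeplitz l x + toeplitz l y" for x y
    by (rule ell2_eqI)
       (simp add: ell2_nth_toeplitz[OF assms] plus_ell2.rep_eq ring_distribs sum.distrib)
qed (simp_all add: norm_toeplitz_le[OF assms] scaleR_conv_scaleC toeplitz_scaleC[OF assms])

lemma toeplitz_trunc:
  assumes "condition_d (ell2_nth l)"
  shows "toeplitz l (ell2_trunc N a) = shift_sum l a N"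
proof (rule ell2_eqI)
  fix n
  have "(\<Sum>j\<le>n. ell2_nth (ell2_trunc N a) j * ell2_nth l (n - j)) = (\<Sum>j\<le>min n N. a j * ell2_nth l (n - j))"
    by (rule sum.mono_neutral_cong_right) (auto simp: ell2_trunc.rep_eq)
  then show "ell2_nth (toeplitz l (ell2_trunc N a)) n = ell2_nth (shift_sum l a N) n"
    by (simp add: ell2_nth_toeplitz[OF assms] ell2_nth_shift_sum)
qed

lemma shift_sum_tendsto_toeplitz:
  assumes "condition_d (ell2_nth l)"
  shows "(\<lambda>N. shift_sum l (ell2_nth c) N) \<longlonglongrightarrow> toeplitz l c"
  using bounded_linear.tendsto[OF bounded_linear_toeplitz[OF assms] ell2_trunc_tendsto]
  by (simp add: toeplitz_trunc[OF assms])

text \<open>On truncations this is (d); the contraction bound makes \<open>toeplitz l\<close>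
  continuous, so equality passes to the limit.\<close>

lemma norm_toeplitz:
  assumes "condition_d (ell2_nth l)"
  shows "norm (toeplitz l c) = norm c"
proof -
  have "norm (shift_sum l (ell2_nth c) N) = norm (ell2_trunc N (ell2_nth c))" for N
  proof (rule power2_eq_imp_eq)
    show "(norm (shift_sum l (ell2_nth c) N))\<^sup>2 = (norm (ell2_trunc N (ell2_nth c)))\<^sup>2"
      using assms by (simp add: condition_d_iff norm_ell2_trunc)
  qed auto
  then have "(\<lambda>N. norm (ell2_trunc N (ell2_nth c))) \<longlonglongrightarrow> norm (toeplitz l c)"
    using tendsto_norm[OF shift_sum_tendsto_toeplitz[OF assms, of c]] by simp
  then show ?thesis
    using tendsto_norm[OF ell2_trunc_tendsto] by (rule LIMSEQ_unique)
qed

text \<open>From (d), (c) is the isometry of \<open>toeplitz l\<close>; conversely, (d) is (c) for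
  truncated sequences.\<close>

lemma condition_c_iff_condition_d: "condition_c (ell2_nth l) \<longleftrightarrow> condition_d (ell2_nth l)"
proof
  assume d: "condition_d (ell2_nth l)"
  show "condition_c (ell2_nth l)"
    unfolding condition_c_def
  proof (intro allI impI)
    fix a assume a: "square_summable a"
    define c where "c = Abs_ell2 a"
    have c: "ell2_nth c = a"
      using a by (simp add: c_def Abs_ell2_inverse)
    show "summable (\<lambda>n. (cmod (\<Sum>j\<le>n. a j * ell2_nth l (n - j)))\<^sup>2) \<and>
      (\<Sum>n. (cmod (\<Sum>j\<le>n. a j * ell2_nth l (n - j)))\<^sup>2) = (\<Sum>n. (cmod (a n))\<^sup>2)"
      using summable_ell2[of "toeplitz l c"] norm_ell2_sq[of "toeplitz l c"] norm_ell2_sq[of c]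
      by (simp add: ell2_nth_toeplitz[OF d] norm_toeplitz[OF d] c)
  qed
next
  assume c: "condition_c (ell2_nth l)"
  show "condition_d (ell2_nth l)"
    unfolding condition_d_iff
  proof (intro allI)
    fix N a
    have "ell2_nth (shift_sum l a N) = (\<lambda>n. \<Sum>j\<le>n. ell2_nth (ell2_trunc N a) j * ell2_nth l (n - j))"
      unfolding ell2_nth_shift_sum
      by (intro ext sum.mono_neutral_cong_left) (auto simp: ell2_trunc.rep_eq)
    moreover have "square_summable (ell2_nth (ell2_trunc N a))"
      by (rule square_summable_ell2_nth)
    ultimately have "(norm (shift_sum l a N))\<^sup>2 = (norm (ell2_trunc N a))\<^sup>2"
      using c by (simp add: condition_c_def norm_ell2_sq)
    then show "(norm (shift_sum l a N))\<^sup>2 = (\<Sum>n\<le>N. (cmod (a n))\<^sup>2)"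
      by (simp add: norm_ell2_trunc)
  qed
qed

text \<open>An isometric image of a complete space is complete. Closedness is what provides elements
  of least norm in translates of the range.\<close>

lemma closed_range_toeplitz:
  assumes "condition_d (ell2_nth l)"
  shows "closed (range (toeplitz l))"
proof (rule complete_imp_closed)
  show "complete (range (toeplitz l))"
    using norm_toeplitz[OF assms]
    by (intro complete_isometric_image[OF zero_less_one subspace_UNIV bounded_linear_toeplitz[OF assms]])
       (simp_all add: complete_UNIV)
qed

lemma toeplitz_in_subspace:
  assumes "complex_ell2.subspace M" "closed M" "shift ` M \<subseteq> M" "l \<in> M" "condition_d (ell2_nth l)"
  shows "toeplitz l c \<in> M"
proof (rule closed_sequentially[OF assms(2)])
  show "shift_sum l (ell2_nth c) n \<in> M" for n
    using assms by (intro shift_sum_in_subspace)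
  show "(\<lambda>n. shift_sum l (ell2_nth c) n) \<longlonglongrightarrow> toeplitz l c"
    using assms by (intro shift_sum_tendsto_toeplitz)
qed

subsection \<open>Beurling's theorem\<close>

text \<open>The minimal-norm element of \<open>{f \<in> M. f\<^sub>k = 1}\<close>, for the least \<open>k\<close> at which not all of
  \<open>M\<close> vanishes, is orthogonal to \<open>S M\<close> because all elements of \<open>S M\<close> vanish at \<open>k\<close>.\<close>

lemma ex_wandering_vector:
  assumes M: "complex_ell2.subspace M" "closed M" "M \<noteq> {0}" "shift ` M \<subseteq> M"
  shows "\<exists>l\<in>M. norm l = 1 \<and> (\<forall>x\<in>M. l \<bullet> shift x = 0)"
proof -
  have sub: "subspace M"
    using M(1) by (rule complex_subspace_imp_subspace)
  have "0 \<in> M"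
    using M(1) by (rule complex_ell2.subspace_0)
  then obtain g where g: "g \<in> M" "g \<noteq> 0"
    using M(3) by auto
  then have "\<exists>k. ell2_nth g k \<noteq> 0"
    using ell2_eqI[of g 0] by (auto simp: zero_ell2.rep_eq)
  then have ex: "\<exists>k. \<exists>f\<in>M. ell2_nth f k \<noteq> 0"
    using g by blast
  define k where "k = (LEAST k. \<exists>f\<in>M. ell2_nth f k \<noteq> 0)"
  obtain f where f: "f \<in> M" "ell2_nth f k \<noteq> 0"
    using LeastI_ex[OF ex] unfolding k_def by blast
  have vanish: "ell2_nth x m = 0" if "x \<in> M" "m < k" for x m
    using not_less_Least[of m "\<lambda>k. \<exists>f\<in>M. ell2_nth f k \<noteq> 0"] that unfolding k_def by blast
  have shift_vanish: "ell2_nth (shift x) k = 0" if "x \<in> M" for x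
    using vanish[OF that] by (auto simp: shift.rep_eq split: nat.split)
  define A where "A = M \<inter> {x. ell2_nth x k = 1}"
  have "closed A"
    unfolding A_def
    by (intro closed_Int M closed_Collect_eq continuous_on_const
        linear_continuous_on[OF bounded_linear_ell2_nth])
  moreover have "convex A"
    unfolding A_def using subspace_imp_convex[OF sub]
    by (intro convex_Int)
       (auto simp: convex_def plus_ell2.rep_eq scaleR_ell2.rep_eq scaleR_left_distrib[symmetric])
  moreover have "scaleC (1 / ell2_nth f k) f \<in> A"
    using f M(1) by (auto simp: A_def scaleC.rep_eq intro: complex_ell2.subspace_scale)
  ultimately obtain x where x: "x \<in> A" "\<forall>y\<in>A. norm x \<le> norm y"
    using ex_min_norm by blast
  have orth: "x \<bullet> shift y = 0" if "y \<in> M" for y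
  proof (rule min_norm_orthogonal[OF \<open>closed A\<close> \<open>convex A\<close> x])
    have "shift y \<in> M"
      using that M(4) by blast
    then show "x + shift y \<in> A" "x - shift y \<in> A"
      using x(1) shift_vanish[OF that] subspace_add[OF sub] subspace_diff[OF sub]
      by (auto simp: A_def plus_ell2.rep_eq minus_ell2.rep_eq)
  qed
  have "x \<noteq> 0"
    using x(1) by (auto simp: A_def zero_ell2.rep_eq)
  moreover have "x \<in> M"
    using x(1) by (simp add: A_def)
  ultimately show ?thesis
    using orth subspace_scale[OF sub \<open>x \<in> M\<close>, of "1 / norm x"]
    by (intro bexI[of _ "(1 / norm x) *\<^sub>R x"]) auto
qed

text \<open>Taking \<open>z = 1\<close> kills the real part of the complex inner product, and
  \<open>z = - \<i>\<close> its imaginary part.\<close>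

lemma sums_zero_if_orthogonal:
  assumes "\<And>z. x \<bullet> scaleC z y = 0"
  shows "(\<lambda>n. cnj (ell2_nth x n) * ell2_nth y n) sums 0"
proof -
  have sums: "(\<lambda>n. ell2_nth x n \<bullet> ell2_nth (scaleC z y) n) sums 0" for z
    using summable_sums[OF square_summable_inner[OF square_summable_ell2_nth[of x]
        square_summable_ell2_nth[of "scaleC z y"]]] assms[of z]
    by (simp add: inner_ell2_def)
  have "(\<lambda>n. Re (cnj (ell2_nth x n) * ell2_nth y n)) sums 0"
    using sums[of 1] by (simp add: inner_complex_def)
  moreover have "(\<lambda>n. Im (cnj (ell2_nth x n) * ell2_nth y n)) sums 0"
    using sums[of "- \<i>"] by (simp add: scaleC.rep_eq uminus_ell2.rep_eq inner_complex_def algebra_simps)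
  ultimately show ?thesis
    by (simp add: sums_complex_iff)
qed

text \<open>The hypothesis says that all two-sided cross-correlations of \<open>f\<close> and \<open>l\<close> vanish, that is,
  \<open>l\<close> convolved on the integers with the conjugate reflection of \<open>f\<close> is zero. Convolution with \<open>l\<close>
  is isometric on finitely supported sequences, so the part of the reflection up to \<open>P\<close>, which
  convolves to \<open>h\<close>, and the remaining tail, which convolves to the negative of \<open>h\<close>, have images of
  equal norm; letting \<open>P\<close> grow, \<open>\<parallel>f\<parallel> = 0\<close>.\<close>

lemma eq_zero_if_orthogonal_orbits:
  assumes d: "condition_d (ell2_nth l)"
    and orth: "\<And>n p z. (shift ^^ n) f \<bullet> scaleC z ((shift ^^ p) l) = 0"
  shows "f = 0"
proof -
  define F where "F = ell2_nth f"
  \<comment> \<open>The lag is the integer \<open>n - P\<close>, so both signs occur. The first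
    \<open>n\<close> coordinates of \<open>(shift ^^ n) f\<close> are 0 and drop out.\<close>
  have corr: "(\<lambda>k. cnj (F k) * ell2_nth ((shift ^^ P) l) (k + n)) sums 0" for n P
  proof -
    have "(\<lambda>k. cnj (ell2_nth ((shift ^^ n) f) k) * ell2_nth ((shift ^^ P) l) k) sums 0"
      by (intro sums_zero_if_orthogonal orth)
    then show ?thesis
      by (subst (asm) sums_zero_iff_shift[symmetric, of n]) (simp_all add: ell2_nth_funpow_shift F_def)
  qed
  have half: "2 * (\<Sum>k\<le>P. (cmod (F k))\<^sup>2) \<le> (norm f)\<^sup>2" for P
  proof -
    \<comment> \<open>The conjugate reflection of \<open>F\<close> up to index \<open>P\<close>,
      moved right by \<open>P\<close> to make its indices non-negative, is convolved with
      \<open>l\<close>.\<close>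
    define h where "h = shift_sum l (\<lambda>j. cnj (F (P - j))) P"
    \<comment> \<open>The values of \<open>F\<close> at indices in \<open>{P<..N}\<close>, reflected
      and moved right by \<open>N\<close>; \<open>j + P < N\<close> means that \<open>N - j\<close>
      exceeds \<open>P\<close>.\<close>
    define b where "b = (\<lambda>N j. if j + P < N then cnj (F (N - j)) else 0)"
    define t where "t = (\<lambda>N. shift_sum l (b N) N)"
    have h: "ell2_nth h n = (\<Sum>k\<le>P. cnj (F k) * ell2_nth ((shift ^^ P) l) (k + n))" for n
    proof -
      have "ell2_nth h n = (\<Sum>j\<le>P. cnj (F (P - j)) * ell2_nth ((shift ^^ j) l) n)"
        by (simp add: h_def shift_sum_def ell2_nth_sum scaleC.rep_eq)
      also have "\<dots> = (\<Sum>k\<le>P. cnj (F k) * ell2_nth ((shift ^^ P) l) (k + n))"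
        by (rule sum.reindex_bij_witness[where i = "\<lambda>k. P - k" and j = "\<lambda>k. P - k"])
           (auto simp: ell2_nth_funpow_shift)
      finally show ?thesis .
    qed
    have norm_h: "(norm h)\<^sup>2 = (\<Sum>k\<le>P. (cmod (F k))\<^sup>2)"
    proof -
      have "(norm h)\<^sup>2 = (\<Sum>j\<le>P. (cmod (F (P - j)))\<^sup>2)"
        using d by (simp add: h_def condition_d_iff)
      also have "\<dots> = (\<Sum>k\<le>P. (cmod (F k))\<^sup>2)"
        by (rule sum.reindex_bij_witness[where i = "\<lambda>k. P - k" and j = "\<lambda>k. P - k"]) auto
      finally show ?thesis .
    qed
    have split: "(\<Sum>k\<in>{P<..N}. g k) = (\<Sum>k\<le>N. g k) - (\<Sum>k\<le>P. g k)"
      if "P \<le> N" for N and g :: "nat \<Rightarrow> 'a::ab_group_add"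
    proof -
      have "{..N} = {..P} \<union> {P<..N}"
        using that by auto
      then have "(\<Sum>k\<le>N. g k) = (\<Sum>k\<le>P. g k) + (\<Sum>k\<in>{P<..N}. g k)"
        by (simp add: sum.union_disjoint ivl_disj_int)
      then show ?thesis
        by simp
    qed
    have norm_t: "(norm (t N))\<^sup>2 \<le> (norm f)\<^sup>2 - (norm h)\<^sup>2" if "P \<le> N" for N
    proof -
      have "(norm (t N))\<^sup>2 = (\<Sum>j\<le>N. (cmod (b N j))\<^sup>2)"
        using d by (simp add: t_def condition_d_iff)
      also have "\<dots> = (\<Sum>j<N - P. (cmod (F (N - j)))\<^sup>2)"
        by (rule sum.mono_neutral_cong_right) (auto simp: b_def)
      also have "\<dots> = (\<Sum>k\<in>{P<..N}. (cmod (F k))\<^sup>2)"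
        by (rule sum.reindex_bij_witness[where i = "\<lambda>k. N - k" and j = "\<lambda>k. N - k"]) auto
      also have "\<dots> = (\<Sum>k\<le>N. (cmod (F k))\<^sup>2) - (norm h)\<^sup>2"
        by (simp add: split[OF that] norm_h)
      also have "\<dots> \<le> (norm f)\<^sup>2 - (norm h)\<^sup>2"
        using ell2_partial_sum_le[of "{..N}" f] by (simp add: F_def)
      finally show ?thesis .
    qed
    \<comment> \<open>The offset \<open>N - P\<close> compensates for the different moves in
      \<open>h\<close> and \<open>t N\<close>. Once aligned, they add up to a partial sum of
      \<open>corr\<close>, which tends to 0.\<close>
    have t: "ell2_nth (t N) (n + (N - P)) =
        (\<Sum>k\<le>N. cnj (F k) * ell2_nth ((shift ^^ P) l) (k + n)) - ell2_nth h n"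
      if "P \<le> N" for n N
    proof -
      have "ell2_nth (t N) (n + (N - P)) = (\<Sum>j\<le>N. b N j * ell2_nth ((shift ^^ j) l) (n + (N - P)))"
        by (simp add: t_def shift_sum_def ell2_nth_sum scaleC.rep_eq)
      also have "\<dots> = (\<Sum>j<N - P. cnj (F (N - j)) * ell2_nth ((shift ^^ j) l) (n + (N - P)))"
        by (rule sum.mono_neutral_cong_right) (auto simp: b_def)
      also have "\<dots> = (\<Sum>k\<in>{P<..N}. cnj (F k) * ell2_nth ((shift ^^ P) l) (k + n))"
        by (rule sum.reindex_bij_witness[where i = "\<lambda>k. N - k" and j = "\<lambda>k. N - k"])
           (auto simp: ell2_nth_funpow_shift algebra_simps)
      finally show ?thesis
        by (simp add: split[OF that] h)
    qed
    have t_tendsto: "(\<lambda>N. ell2_nth (t N) (n + (N - P))) \<longlonglongrightarrow> - ell2_nth h n" for n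
    proof (rule Lim_transform_eventually)
      show "(\<lambda>N. (\<Sum>k\<le>N. cnj (F k) * ell2_nth ((shift ^^ P) l) (k + n)) - ell2_nth h n)
          \<longlonglongrightarrow> - ell2_nth h n"
        using tendsto_diff[OF corr[of P n, unfolded sums_def_le] tendsto_const[of "ell2_nth h n"]]
        by simp
      show "\<forall>\<^sub>F N in sequentially. (\<Sum>k\<le>N. cnj (F k) * ell2_nth ((shift ^^ P) l) (k + n))
          - ell2_nth h n = ell2_nth (t N) (n + (N - P))"
        using t by (intro eventually_sequentiallyI[of P]) simp
    qed
    \<comment> \<open>Only coordinatewise convergence of the moved \<open>t N\<close> is known, so
      the norm bound is passed on through finite sums.\<close>
    have "(\<Sum>n<K. (cmod (- ell2_nth h n))\<^sup>2) \<le> (norm f)\<^sup>2 - (norm h)\<^sup>2" for K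
    proof (rule Lim_bounded)
      show "(\<lambda>N. \<Sum>n<K. (cmod (ell2_nth (t N) (n + (N - P))))\<^sup>2)
          \<longlonglongrightarrow> (\<Sum>n<K. (cmod (- ell2_nth h n))\<^sup>2)"
        by (intro tendsto_intros t_tendsto)
      show "\<forall>N\<ge>P. (\<Sum>n<K. (cmod (ell2_nth (t N) (n + (N - P))))\<^sup>2) \<le> (norm f)\<^sup>2 - (norm h)\<^sup>2"
      proof (intro allI impI)
        fix N assume N: "P \<le> N"
        have "(\<Sum>n<K. (cmod (ell2_nth (t N) (n + (N - P))))\<^sup>2)
            = (\<Sum>n\<in>(\<lambda>n. n + (N - P)) ` {..<K}. (cmod (ell2_nth (t N) n))\<^sup>2)"
          by (subst sum.reindex) (auto simp: inj_on_def)
        also have "\<dots> \<le> (norm (t N))\<^sup>2"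
          by (rule ell2_partial_sum_le) simp
        finally show "(\<Sum>n<K. (cmod (ell2_nth (t N) (n + (N - P))))\<^sup>2) \<le> (norm f)\<^sup>2 - (norm h)\<^sup>2"
          using norm_t[OF N] by simp
      qed
    qed
    then have "(norm h)\<^sup>2 \<le> (norm f)\<^sup>2 - (norm h)\<^sup>2"
      unfolding norm_ell2_sq[of h] by (intro suminf_le_const summable_ell2) simp
    then show ?thesis
      by (simp add: norm_h)
  qed
  have "2 * (norm f)\<^sup>2 \<le> (norm f)\<^sup>2"
  proof (rule LIMSEQ_le_const2)
    show "(\<lambda>P. 2 * (\<Sum>k\<le>P. (cmod (F k))\<^sup>2)) \<longlonglongrightarrow> 2 * (norm f)\<^sup>2"
      unfolding norm_ell2_sq F_def by (intro tendsto_intros summable_LIMSEQ' summable_ell2)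
    show "\<exists>P0. \<forall>P\<ge>P0. 2 * (\<Sum>k\<le>P. (cmod (F k))\<^sup>2) \<le> (norm f)\<^sup>2"
      using half by blast
  qed
  then show ?thesis
    by simp
qed

lemma range_toeplitz_wandering:
  assumes M: "complex_ell2.subspace M" "closed M" "shift ` M \<subseteq> M" "l \<in> M"
    and d: "condition_d (ell2_nth l)"
    and wandering: "\<And>x. x \<in> M \<Longrightarrow> l \<bullet> shift x = 0"
  shows "range (toeplitz l) = M"
proof
  have T: "toeplitz l c \<in> M" for c
    using M d by (rule toeplitz_in_subspace)
  then show "range (toeplitz l) \<subseteq> M"
    by blast
  show "M \<subseteq> range (toeplitz l)"
  proof
    fix f assume f: "f \<in> M"
    have lin: "linear (toeplitz l)"
      using bounded_linear_toeplitz[OF d] by (rule bounded_linear.linear)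
    \<comment> \<open>The element of least norm in this coset is the component of \<open>f\<close>
      orthogonal to the range.\<close>
    define A where "A = (+) f ` range (toeplitz l)"
    have A: "closed A" "convex A" "A \<noteq> {}"
      unfolding A_def using closed_range_toeplitz[OF d] lin
      by (auto intro!: closed_translation convex_translation convex_linear_image)
    obtain x where x: "x \<in> A" "\<forall>y\<in>A. norm x \<le> norm y"
      using ex_min_norm[OF A] by blast
    obtain c where c: "x = f + toeplitz l c"
      using x(1) by (auto simp: A_def)
    have orth: "x \<bullet> toeplitz l a = 0" for a
    proof (rule min_norm_orthogonal[OF A(1,2) x])
      have "x + toeplitz l a = f + toeplitz l (c + a)" "x - toeplitz l a = f + toeplitz l (c - a)"
        by (simp_all add: c linear_add[OF lin] linear_diff[OF lin])
      then show "x + toeplitz l a \<in> A" "x - toeplitz l a \<in> A"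
        by (auto simp: A_def)
    qed
    have "x \<in> M"
      unfolding c using M(1) f T by (rule complex_ell2.subspace_add)
    then have xM: "(shift ^^ n) x \<in> M" for n
      using M(3) by (induction n) auto
    have "x = 0"
    proof (rule eq_zero_if_orthogonal_orbits[OF d])
      fix n p z
      show "(shift ^^ n) x \<bullet> scaleC z ((shift ^^ p) l) = 0"
      proof (cases "n \<le> p")
        case True
        \<comment> \<open>A single coefficient makes \<open>scaleC z ((shift ^^ (p - n)) l)\<close>
          an element of the range; the \<open>n\<close> common shifts cancel.\<close>
        define a where "a = (\<lambda>i. if i = p - n then z else 0)"
        have "shift_sum l a (p - n) = (\<Sum>j\<le>p - n. if j = p - n then scaleC z ((shift ^^ j) l) else 0)"
          unfolding shift_sum_def a_def by (intro sum.cong) auto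
        then have "toeplitz l (ell2_trunc (p - n) a) = scaleC z ((shift ^^ (p - n)) l)"
          by (simp add: toeplitz_trunc[OF d])
        then have "x \<bullet> (shift ^^ (p - n)) (scaleC z l) = 0"
          using orth by (metis funpow_shift_scaleC)
        moreover have "scaleC z ((shift ^^ p) l) = (shift ^^ n) ((shift ^^ (p - n)) (scaleC z l))"
          using True funpow_add[of n "p - n" shift] by (simp add: funpow_shift_scaleC)
        ultimately show ?thesis
          by (simp add: inner_funpow_shift)
      next
        case False
        then obtain m where m: "n = p + Suc m"
          using less_imp_Suc_add[of p n] by auto
        \<comment> \<open>After cancelling \<open>p\<close> shifts, at least one remains on the side
          of \<open>x\<close>, so the wandering property of \<open>l\<close> applies.\<close>
        have "(shift ^^ n) x \<bullet> scaleC z ((shift ^^ p) l) = (shift ^^ Suc m) x \<bullet> scaleC z l"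
          unfolding m funpow_add by (simp add: inner_funpow_shift flip: funpow_shift_scaleC)
        also have "\<dots> = l \<bullet> shift (scaleC (cnj z) ((shift ^^ m) x))"
          by (simp add: shift_scaleC inner_scaleC_left inner_commute flip: inner_scaleC_left)
        also have "\<dots> = 0"
          using M(1) xM by (intro wandering complex_ell2.subspace_scale)
        finally show ?thesis .
      qed
    qed
    then have "f = toeplitz l (- c)"
      using c by (simp add: linear_neg[OF lin] eq_neg_iff_add_eq_0)
    then show "f \<in> range (toeplitz l)"
      by blast
  qed
qed

text \<open>Conditions (c) and (d) put the coefficients before \<open>l\<close>, the description of
  \<open>M\<close> puts them after it.\<close>

lemma convolution_commute:
  fixes u v :: "nat \<Rightarrow> 'a::comm_semiring_0"
  shows "(\<Sum>j\<le>n. u j * v (n - j)) = (\<Sum>k\<le>n. v k * u (n - k))"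
  by (rule sum.reindex_bij_witness[where i = "\<lambda>k. n - k" and j = "\<lambda>k. n - k"])
     (auto simp: mult.commute)

text \<open>Non-trivial means nonzero here; the whole space is allowed. The last conjunct renders
  the remark that either condition entails both.\<close>

theorem corollary1:
  fixes M :: "ell2 set"
  assumes "complex_ell2.subspace M" and "closed M" and "M \<noteq> {0}"
  shows "(shift ` M \<subseteq> M \<longleftrightarrow>
      (\<exists>l\<in>M. (condition_c (ell2_nth l) \<or> condition_d (ell2_nth l)) \<and>
        ell2_nth ` M = {\<lambda>n. \<Sum>k\<le>n. ell2_nth l k * ell2_nth c (n - k) | c. True}))
    \<and> (\<forall>l\<in>M. condition_c (ell2_nth l) \<longleftrightarrow> condition_d (ell2_nth l))"
proof (intro conjI iffI ballI)
  assume inv: "shift ` M \<subseteq> M"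
  obtain l where l: "l \<in> M" "norm l = 1" "\<And>x. x \<in> M \<Longrightarrow> l \<bullet> shift x = 0"
    using ex_wandering_vector[OF assms inv] by blast
  have d: "condition_d (ell2_nth l)"
    unfolding condition_d_iff using norm_shift_sum_wandering[OF assms(1) inv l] by blast
  have "ell2_nth (toeplitz l c) = (\<lambda>n. \<Sum>k\<le>n. ell2_nth l k * ell2_nth c (n - k))" for c
    by (simp add: fun_eq_iff ell2_nth_toeplitz[OF d] convolution_commute[of "ell2_nth c"])
  then have "ell2_nth ` range (toeplitz l) =
      {\<lambda>n. \<Sum>k\<le>n. ell2_nth l k * ell2_nth c (n - k) | c. True}"
    by (auto simp: image_image)
  then have "ell2_nth ` M = {\<lambda>n. \<Sum>k\<le>n. ell2_nth l k * ell2_nth c (n - k) | c. True}"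
    using range_toeplitz_wandering[OF assms(1,2) inv l(1) d l(3)] by simp
  then show "\<exists>l\<in>M. (condition_c (ell2_nth l) \<or> condition_d (ell2_nth l)) \<and>
      ell2_nth ` M = {\<lambda>n. \<Sum>k\<le>n. ell2_nth l k * ell2_nth c (n - k) | c. True}"
    using l(1) d by blast
next
  assume "\<exists>l\<in>M. (condition_c (ell2_nth l) \<or> condition_d (ell2_nth l)) \<and>
      ell2_nth ` M = {\<lambda>n. \<Sum>k\<le>n. ell2_nth l k * ell2_nth c (n - k) | c. True}"
  then obtain l where l: "ell2_nth ` M = {\<lambda>n. \<Sum>k\<le>n. ell2_nth l k * ell2_nth c (n - k) | c. True}"
    by blast
  show "shift ` M \<subseteq> M"
  proof (rule image_subsetI)
    fix f assume "f \<in> M"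
    then obtain c where c: "ell2_nth f = (\<lambda>n. \<Sum>k\<le>n. ell2_nth l k * ell2_nth c (n - k))"
      using l by blast
    \<comment> \<open>The shift commutes with convolution, so \<open>shift c\<close> represents
      \<open>shift f\<close>; the top term vanishes because \<open>shift c\<close> is 0 at index
      0.\<close>
    have "ell2_nth (shift f) n = (\<Sum>k\<le>n. ell2_nth l k * ell2_nth (shift c) (n - k))" for n
    proof (cases n)
      case (Suc m)
      have "(\<Sum>k\<le>m. ell2_nth l k * ell2_nth (shift c) (Suc m - k)) =
          (\<Sum>k\<le>m. ell2_nth l k * ell2_nth c (m - k))"
        by (intro sum.cong) (auto simp: shift.rep_eq Suc_diff_le)
      then show ?thesis
        by (simp add: Suc shift.rep_eq c)
    qed (simp add: shift.rep_eq)
    then have "ell2_nth (shift f) \<in> ell2_nth ` M"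
      unfolding l by blast
    then show "shift f \<in> M"
      by (auto simp: ell2_nth_inject)
  qed
qed (use condition_c_iff_condition_d in auto)

end
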